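(* As formal power series in $z$, $$\sum_{n\ge0}\phi(n,n;T)\,\frac{z^n}{n!}=\frac{-2\,W(-ze^{z})}{z+z\,W(-ze^z)}+(z^2-1)e^{2z}-2z(z+1)e^{4z}.$$
   Context: A $(0,1)$-matrix is a matrix with all entries in $\{0,1\}$. A $2\times2$ submatrix of a matrix is obtained by choosing two rows $i_1<i_2$ and two columns $j_1<j_2$. Let $T=\begin{pmatrix}1&1\\0&0\end{pmatrix}$ and let $[T]=\left\{\begin{pmatrix}1&1\\0&0\end{pmatrix},\begin{pmatrix}0&0\\1&1\end{pmatrix}\right\}$ be its equivalence class under row and column exchanges. For $n\ge1$, $\phi(n,n;T)$ is the number of $n\times n$ $(0,1)$-matrices having no $2\times2$ submatrix in $[T]$, and $\phi(0,0;T)=1$. $W$ denotes the Lambert $W$-function as the formal power series $W(x)=\sum_{n\ge1}(-n)^{n-1}\frac{x^n}{n!}$ (the compositional inverse of $W\mapsto We^W$), and $W(-ze^z)$ is the formal composition, a power series in $z$ with zero constant term. *)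

theory Defs
  imports
    "HOL-Computational_Algebra.Formal_Power_Series"
    "HOL-Combinatorics.Permutations"
    "Jordan_Normal_Form.DL_Submatrix"
begin

definition zero_one_mats :: "nat \<Rightarrow> nat \<Rightarrow> nat mat set" where
  "zero_one_mats k n = {A \<in> carrier_mat k n. elements_mat A \<subseteq> {0, 1}}"

definition exchange_class :: "'a mat \<Rightarrow> 'a mat set" where
  "exchange_class B =
     {mat (dim_row B) (dim_col B) (\<lambda>(i, j). B $$ (p i, q j)) | p q.
        p permutes {..<dim_row B} \<and> q permutes {..<dim_col B}}"

(* The forbidden configurations are 2 x 2 submatrices, so B is meant to be a 2 x 2 matrix. *)
definition avoids :: "'a mat \<Rightarrow> 'a mat \<Rightarrow> bool" where
  "avoids A B \<longleftrightarrow>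
     (\<forall>i\<^sub>1 i\<^sub>2 j\<^sub>1 j\<^sub>2. i\<^sub>1 < i\<^sub>2 \<and> i\<^sub>2 < dim_row A \<and> j\<^sub>1 < j\<^sub>2 \<and> j\<^sub>2 < dim_col A \<longrightarrow>
        submatrix A {i\<^sub>1, i\<^sub>2} {j\<^sub>1, j\<^sub>2} \<notin> exchange_class B)"

definition phi :: "nat \<Rightarrow> nat \<Rightarrow> nat mat \<Rightarrow> nat" where
  "phi k n B = card {A \<in> zero_one_mats k n. avoids A B}"

definition T :: "nat mat" where
  "T = mat_of_rows_list 2 [[1, 1], [0, 0]]"

definition lambert_W :: "rat fps" where
  "lambert_W = Abs_fps (\<lambda>n. if n = 0 then 0 else (- of_nat n) ^ (n - 1) / fact n)"

definition lambert_W_comp :: "rat fps" where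
  "lambert_W_comp = lambert_W oo (- fps_X * fps_exp 1)"

lemma exchange_class_T:
  "exchange_class T = {mat_of_rows_list 2 [[1, 1], [0, 0]], mat_of_rows_list 2 [[0, 0], [1, 1]]}"
proof -
  have d: "dim_row T = 2" "dim_col T = 2"
    by (simp_all add: T_def mat_of_rows_list_def)
  have two: "{..<2} = {0, 1 :: nat}" by auto
  have "exchange_class T = {mat 2 2 (\<lambda>(i, j). T $$ (p i, q j)) | p q.
      (p = id \<or> p = Transposition.transpose 0 1) \<and> (q = id \<or> q = Transposition.transpose 0 1)}"
    by (simp only: exchange_class_def d two permutes_doubleton_iff)
  also have "\<dots> = {mat 2 2 (\<lambda>(i, j). T $$ (i, j)),
      mat 2 2 (\<lambda>(i, j). T $$ (Transposition.transpose 0 1 i, j)),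
      mat 2 2 (\<lambda>(i, j). T $$ (i, Transposition.transpose 0 1 j)),
      mat 2 2 (\<lambda>(i, j). T $$ (Transposition.transpose 0 1 i, Transposition.transpose 0 1 j))}"
    (is "?L = {?a, ?b, ?c, ?e}")
  proof
    show "?L \<subseteq> {?a, ?b, ?c, ?e}" by auto
    have "?a \<in> ?L" by (rule CollectI, rule exI[of _ id], rule exI[of _ id]) simp
    moreover have "?b \<in> ?L"
      by (rule CollectI, rule exI[of _ "Transposition.transpose 0 1"], rule exI[of _ id]) simp
    moreover have "?c \<in> ?L"
      by (rule CollectI, rule exI[of _ id], rule exI[of _ "Transposition.transpose 0 1"]) simp
    moreover have "?e \<in> ?L"
      by (rule CollectI, rule exI[of _ "Transposition.transpose 0 1"],
          rule exI[of _ "Transposition.transpose 0 1"]) simp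
    ultimately show "{?a, ?b, ?c, ?e} \<subseteq> ?L" by blast
  qed
  also have "?a = mat_of_rows_list 2 [[1, 1], [0, 0]]"
    by (rule eq_matI) (auto simp: T_def mat_of_rows_list_def)
  also have "?b = mat_of_rows_list 2 [[0, 0], [1, 1]]"
    by (rule eq_matI) (auto simp: T_def mat_of_rows_list_def less_Suc_eq numeral_2_eq_2 Transposition.transpose_def)
  also have "?c = mat_of_rows_list 2 [[1, 1], [0, 0]]"
    by (rule eq_matI) (auto simp: T_def mat_of_rows_list_def less_Suc_eq numeral_2_eq_2 Transposition.transpose_def)
  also have "?e = mat_of_rows_list 2 [[0, 0], [1, 1]]"
    by (rule eq_matI) (auto simp: T_def mat_of_rows_list_def less_Suc_eq numeral_2_eq_2 Transposition.transpose_def)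
  finally show ?thesis by auto
qed

lemma phi_0_0: "phi 0 0 B = 1"
proof -
  have "{A \<in> zero_one_mats 0 0. avoids A B} = {0\<^sub>m 0 0}"
    by (auto simp: zero_one_mats_def avoids_def elements_mat_def)
  then show ?thesis by (simp add: phi_def)
qed

lemma finite_zero_one_mats: "finite (zero_one_mats k n)"
proof (rule finite_subset)
  let ?F = "({..<k} \<times> {..<n}) \<rightarrow>\<^sub>E {0, 1 :: nat}"
  show "zero_one_mats k n \<subseteq> mat k n ` ?F"
  proof
    fix A assume A: "A \<in> zero_one_mats k n"
    let ?f = "restrict (\<lambda>p. A $$ p) ({..<k} \<times> {..<n})"
    have "A = mat k n ?f"
      using A by (intro eq_matI) (auto simp: zero_one_mats_def)
    moreover have "?f \<in> ?F"
      using A by (fastforce simp: zero_one_mats_def)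
    ultimately show "A \<in> mat k n ` ?F" by blast
  qed
  show "finite (mat k n ` ?F)"
    by (intro finite_imageI finite_PiE) auto
qed

(* Division of formal power series in the library truncates; here numerator and
   denominator both have order 1, so the quotient is the exact one. *)
lemma lambert_W_comp_quotient_exact:
  "(fps_X + fps_X * lambert_W_comp) dvd (- 2 * lambert_W_comp)"
  "fps_X + fps_X * lambert_W_comp \<noteq> 0"
proof -
  have z: "fps_nth lambert_W_comp 0 = 0"
    by (simp add: lambert_W_comp_def lambert_W_def)
  have s: "fps_X + fps_X * lambert_W_comp = fps_X * (1 + lambert_W_comp)"
    by (simp add: algebra_simps)
  have u: "fps_nth (1 + lambert_W_comp) 0 = 1" using z by simp
  have one: "(1 + lambert_W_comp) dvd 1"
    using u by (metis fps_is_unit_iff one_neq_zero)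
  have "fps_X dvd lambert_W_comp"
  proof (cases "lambert_W_comp = 0")
    case False
    then have "subdegree lambert_W_comp \<noteq> 0"
      using z by (metis nth_subdegree_nonzero)
    with False show ?thesis by (simp add: fps_dvd_iff)
  qed simp
  then have "fps_X * (1 + lambert_W_comp) dvd (- 2 * lambert_W_comp) * 1"
    using one by (intro mult_dvd_mono) auto
  then show "(fps_X + fps_X * lambert_W_comp) dvd (- 2 * lambert_W_comp)"
    by (simp add: s)
  show "fps_X + fps_X * lambert_W_comp \<noteq> 0"
    unfolding s using u by (metis fps_X_neq_zero mult_eq_0_iff fps_zero_nth one_neq_zero)
qed

end

theory Submission
  imports Defs
begin

text \<open>
  Read the rows of a 0-1 matrix as subsets of the set \<open>J\<close> of columns. Avoiding the two forbidden
  submatrices says exactly that any two rows \<open>A\<close>, \<open>B\<close> are near: neither contains two elements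
  missing from the other. The structural fact (\<open>pairwise_near_iff\<close>) is that a family of subsets is
  pairwise near iff all its members arise from one set \<open>S\<close> by removing at most one element, or all
  arise from one set \<open>K\<close> by adding at most one element.

  For a given \<open>S\<close> with \<open>k\<close> elements there are \<open>(k + 1) ^ m\<close> matrices with \<open>m\<close> rows of the first
  kind. The set \<open>S\<close> becomes unique if it is required to be the union of the rows, which excludes only
  the \<open>k\<close> constant choices \<open>S - {x}\<close> (\<open>card_below_fns\<close>). The second kind is equinumerous by
  complementation. The matrices of both kinds are those with at most two distinct
  rows, near each other, and they are counted through the near pairs (\<open>card_below_above_fns\<close>).
  Inclusion-exclusion gives, for \<open>n > 0\<close>, the closed form \<open>phi_T_square\<close>, whose
  main term is twice the sum of \<open>(n choose k) * (k + 1) ^ n\<close>; the other terms are polynomials in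
  \<open>n\<close> times \<open>2 ^ n\<close> and \<open>4 ^ n\<close>, hence \<open>n!\<close> times the coefficients of the two exponential summands. The
  formula also holds for \<open>n = 0\<close>.

  For the main term, the series \<open>W\<close> is composed with \<open>f = X e\<^sup>X\<close>. The coefficients of \<open>W \<circ> f\<close> are
  finite differences of powers of too low a degree, so \<open>W \<circ> f = X\<close>. Differentiating gives
  \<open>X W' (1 + W) = W\<close>, so \<open>W / (1 + W)\<close> is the explicit series \<open>X W'\<close>, and substituting \<open>- f\<close>
  yields the sum above as coefficients (\<open>lambert_quotient_nth\<close>).
\<close>

section \<open>Families of pairwise near sets\<close>

definition near :: "'a set \<Rightarrow> 'a set \<Rightarrow> bool" where
  "near A B \<longleftrightarrow> card (A - B) \<le> 1 \<and> card (B - A) \<le> 1"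

definition below1 :: "'a set \<Rightarrow> 'a set set" where
  "below1 S = {R. R \<subseteq> S \<and> card (S - R) \<le> 1}"

definition above1 :: "'a set \<Rightarrow> 'a set \<Rightarrow> 'a set set" where
  "above1 J K = {R. K \<subseteq> R \<and> R \<subseteq> J \<and> card (R - K) \<le> 1}"

lemma card_Diff_le_1_unique:
  assumes "card (A - B) \<le> 1" "finite A" "x \<in> A" "x \<notin> B" "y \<in> A" "y \<notin> B"
  shows "x = y"
  using assms card_le_Suc0_iff_eq[of "A - B"] by auto

lemma card_Diff_le_1_I:
  assumes "finite A" "\<And>x y. x \<in> A \<Longrightarrow> x \<notin> B \<Longrightarrow> y \<in> A \<Longrightarrow> y \<notin> B \<Longrightarrow> x = y"
  shows "card (A - B) \<le> 1"
  using assms card_le_Suc0_iff_eq[of "A - B"] by auto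

text \<open>
  Suppose the union of \<open>F\<close> does not serve as \<open>S\<close>. Then some member \<open>R\<close> misses two elements
  \<open>x\<close>, \<open>y\<close>, which lie in members \<open>A\<close>, \<open>B\<close>. Nearness forces \<open>A = K \<union> {x}\<close> and \<open>B = K \<union> {y}\<close> with
  \<open>K\<close> contained in \<open>R\<close>. No member contains both \<open>x\<close> and \<open>y\<close>, since it would not be near \<open>R\<close>; comparing
  a member with \<open>A\<close> and \<open>B\<close> then shows that it is \<open>K\<close> with at most one element added.
\<close>
lemma pairwise_near_iff:
  assumes J: "finite J" and F: "F \<subseteq> Pow J"
  shows "(\<forall>A\<in>F. \<forall>B\<in>F. near A B) \<longleftrightarrow>
    (\<exists>S\<subseteq>J. F \<subseteq> below1 S) \<or> (\<exists>K\<subseteq>J. F \<subseteq> above1 J K)"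
proof
  assume near: "\<forall>A\<in>F. \<forall>B\<in>F. near A B"
  have fin: "finite A" if "A \<in> F" for A using that J F finite_subset by blast
  have uniq: "x = y" if "A \<in> F" "B \<in> F" "x \<in> A" "x \<notin> B" "y \<in> A" "y \<notin> B" for A B x y
    using near that fin card_Diff_le_1_unique unfolding near_def by metis
  show "(\<exists>S\<subseteq>J. F \<subseteq> below1 S) \<or> (\<exists>K\<subseteq>J. F \<subseteq> above1 J K)"
  proof (cases "F \<subseteq> below1 (\<Union>F)")
    case True
    moreover have "\<Union>F \<subseteq> J" using F by blast
    ultimately show ?thesis by blast
  next
    case False
    then obtain R where R: "R \<in> F" "R \<notin> below1 (\<Union>F)" by blast
    have "finite (\<Union>F)" using J F by (meson Sup_le_iff PowD finite_subset subsetD)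
    then obtain x y where "x \<in> \<Union>F" "y \<in> \<Union>F" and xy: "x \<notin> R" "y \<notin> R" "x \<noteq> y"
      using R card_Diff_le_1_I[of "\<Union>F" R] unfolding below1_def by auto
    then obtain A B where AB: "A \<in> F" "B \<in> F" "x \<in> A" "y \<in> B" by blast
    \<comment> \<open>The proof shows that \<open>K\<close> is also \<open>B \<inter> R\<close>, so that \<open>x\<close> and \<open>y\<close> play symmetric roles.\<close>
    define K where "K = A \<inter> R"
    have "F \<subseteq> above1 J K"
    proof
      fix C assume C: "C \<in> F"
      have nxy: "\<not> (x \<in> C \<and> y \<in> C)" using uniq[OF C R(1)] xy by blast
      have yA: "y \<notin> A" "x \<notin> B" using uniq[OF AB(1) R(1)] uniq[OF AB(2) R(1)] AB xy by blast+
      have AR: "A - R = {x}" using uniq[OF AB(1) R(1)] AB xy by blast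
      have BR: "B - R = {y}" using uniq[OF AB(2) R(1)] AB xy by blast
      have AB': "A - B = {x}" using uniq[OF AB(1,2)] AB yA by blast
      have BA': "B - A = {y}" using uniq[OF AB(2,1)] AB yA by blast
      have KB: "K = B \<inter> R" unfolding K_def using AR BR AB' BA' by blast
      have "K \<subseteq> C"
      proof
        fix k assume k: "k \<in> K"
        show "k \<in> C"
        proof (rule ccontr)
          assume "k \<notin> C"
          then have "x \<in> C"
            using uniq[OF AB(1) C, of k x] k AB(3) xy(1) unfolding K_def by blast
          moreover have "y \<in> C"
            using uniq[OF AB(2) C, of k y] k \<open>k \<notin> C\<close> AB(4) xy(2) unfolding KB by blast
          ultimately show False using nxy by blast
        qed
      qed
      moreover have "card (C - K) \<le> 1"
      proof (rule card_Diff_le_1_I[OF fin[OF C]])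
        fix p q assume pq: "p \<in> C" "p \<notin> K" "q \<in> C" "q \<notin> K"
        show "p = q"
        proof (rule ccontr)
          assume "p \<noteq> q"
          moreover have "p = x \<or> q = x \<or> p = q"
            using uniq[OF C AB(1), of p q] pq AR unfolding K_def by blast
          moreover have "p = y \<or> q = y \<or> p = q"
            using uniq[OF C AB(2), of p q] pq BR unfolding KB by blast
          ultimately show False using nxy pq xy(3) by blast
        qed
      qed
      ultimately show "C \<in> above1 J K" using C F unfolding above1_def by blast
    qed
    moreover have "K \<subseteq> J" using AB F unfolding K_def by blast
    ultimately show ?thesis by blast
  qed
next
  assume "(\<exists>S\<subseteq>J. F \<subseteq> below1 S) \<or> (\<exists>K\<subseteq>J. F \<subseteq> above1 J K)"
  then show "\<forall>A\<in>F. \<forall>B\<in>F. near A B"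
  proof (elim disjE exE conjE)
    fix S assume S: "S \<subseteq> J" "F \<subseteq> below1 S"
    have "card (A - B) \<le> 1" if "A \<in> F" "B \<in> F" for A B
    proof -
      have "card (A - B) \<le> card (S - B)"
        using that S J by (intro card_mono) (auto simp: below1_def intro: finite_subset)
      then show ?thesis using that S unfolding below1_def by fastforce
    qed
    then show ?thesis unfolding near_def by blast
  next
    fix K assume K: "K \<subseteq> J" "F \<subseteq> above1 J K"
    have "card (A - B) \<le> 1" if "A \<in> F" "B \<in> F" for A B
    proof -
      have "card (A - B) \<le> card (A - K)"
        using that K J by (intro card_mono) (auto simp: above1_def intro: finite_subset)
      then show ?thesis using that K unfolding above1_def by fastforce
    qed
    then show ?thesis unfolding near_def by blast
  qed
qed

section \<open>Subset and pair counts\<close>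

lemma below1_eq:
  assumes S: "finite S"
  shows "below1 S = insert S ((\<lambda>x. S - {x}) ` S)"
proof (intro equalityI subsetI)
  fix R assume R: "R \<in> below1 S"
  show "R \<in> insert S ((\<lambda>x. S - {x}) ` S)"
  proof (cases "R = S")
    case False
    then obtain x where x: "x \<in> S" "x \<notin> R" using R unfolding below1_def by blast
    have "y = x" if "y \<in> S" "y \<notin> R" for y
      using card_Diff_le_1_unique[of S R y x] R S x that by (simp add: below1_def)
    then have "R = S - {x}" using R x unfolding below1_def by blast
    then show ?thesis using x by blast
  qed simp
qed (auto simp: below1_def double_diff)

lemma card_below1: "finite S \<Longrightarrow> card (below1 S) = card S + 1"
proof -
  assume S: "finite S"
  have "inj_on (\<lambda>x. S - {x}) S" by (rule inj_onI) blast
  moreover have "S \<notin> (\<lambda>x. S - {x}) ` S" by blast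
  ultimately show ?thesis using S by (simp add: below1_eq card_image)
qed

lemma sum_Pow_card:
  assumes "finite J"
  shows "(\<Sum>S\<in>Pow J. g (card S)) = (\<Sum>k\<le>card J. of_nat (card J choose k) * (g k :: 'b :: comm_semiring_1))"
proof -
  have "(\<Sum>S\<in>Pow J. g (card S)) = (\<Sum>k\<le>card J. \<Sum>S\<in>{S \<in> Pow J. card S = k}. g (card S))"
    using assms by (intro sum.group[symmetric]) (auto intro: card_mono)
  also have "\<dots> = (\<Sum>k\<le>card J. of_nat (card J choose k) * g k)"
    using assms by (intro sum.cong) (auto simp: n_subsets)
  finally show ?thesis .
qed

text \<open>
  A set near \<open>A\<close> is obtained from \<open>A\<close> by independently dropping at most one element of \<open>A\<close> and
  adding at most one element of \<open>J - A\<close>.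
\<close>
lemma card_near_pairs:
  assumes J: "finite J"
  shows "card {(A, B). A \<subseteq> J \<and> B \<subseteq> J \<and> near A B} =
    (\<Sum>k\<le>card J. (card J choose k) * ((k + 1) * (card J - k + 1)))"
proof -
  have inner: "card {B. B \<subseteq> J \<and> near A B} = (card A + 1) * (card J - card A + 1)" if A: "A \<subseteq> J" for A
  proof -
    let ?h = "\<lambda>(P, Q). P \<union> ((J - A) - Q)"
    have "bij_betw ?h (below1 A \<times> below1 (J - A)) {B. B \<subseteq> J \<and> near A B}"
    proof (rule bij_betw_byWitness[where f' = "\<lambda>B. (A \<inter> B, (J - A) - B)"])
      have "A - (P \<union> ((J - A) - Q)) = A - P" "(P \<union> ((J - A) - Q)) - A = (J - A) - Q"
        if "P \<subseteq> A" for P Q using that by blast+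
      then show "?h ` (below1 A \<times> below1 (J - A)) \<subseteq> {B. B \<subseteq> J \<and> near A B}"
        using A by (auto simp: near_def below1_def)
      have "(J - A) - ((J - A) - B) = B - A" "A - A \<inter> B = A - B" if "B \<subseteq> J" for B
        using that by blast+
      then show "(\<lambda>B. (A \<inter> B, (J - A) - B)) ` {B. B \<subseteq> J \<and> near A B} \<subseteq> below1 A \<times> below1 (J - A)"
        by (auto simp: near_def below1_def)
    qed (use A in \<open>auto simp: below1_def\<close>)
    then have "card {B. B \<subseteq> J \<and> near A B} = card (below1 A \<times> below1 (J - A))"
      using bij_betw_same_card by fastforce
    moreover have "finite A" using A J finite_subset by blast
    ultimately show ?thesis
      using A J by (simp add: card_cartesian_product card_below1 card_Diff_subset)
  qed
  have "{(A, B). A \<subseteq> J \<and> B \<subseteq> J \<and> near A B} = Sigma (Pow J) (\<lambda>A. {B. B \<subseteq> J \<and> near A B})" by auto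
  then have "card {(A, B). A \<subseteq> J \<and> B \<subseteq> J \<and> near A B} =
      (\<Sum>A\<in>Pow J. card {B. B \<subseteq> J \<and> near A B})"
    using J by simp
  also have "\<dots> = (\<Sum>A\<in>Pow J. (card A + 1) * (card J - card A + 1))"
    by (intro sum.cong) (auto simp: inner)
  also have "\<dots> = (\<Sum>k\<le>card J. (card J choose k) * ((k + 1) * (card J - k + 1)))"
    using sum_Pow_card[OF J, of "\<lambda>k. (k + 1) * (card J - k + 1)"] by simp
  finally show ?thesis .
qed

lemma choose_mixed_sum: "4 * (\<Sum>k\<le>n. (n choose k) * (k * (n - k))) = n * (n - 1) * 2 ^ n"
proof (cases "n < 2")
  case True
  then consider "n = 0" | "n = 1" by linarith
  then show ?thesis by cases auto
next
  case False
  then obtain m where n: "n = Suc (Suc m)" by (metis add_2_eq_Suc le_Suc_ex not_less)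
  have "(\<Sum>k\<le>n. (n choose k) * (k * (n - k))) = (\<Sum>k\<le>Suc m. (n choose Suc k) * (Suc k * (n - Suc k)))"
    unfolding n by (subst sum.atMost_Suc_shift) simp
  also have "\<dots> = (\<Sum>k\<le>Suc m. n * (Suc m * (m choose k)))"
  proof (rule sum.cong)
    fix k
    have d: "n - Suc k = Suc m - k" by (simp add: n)
    have "(n choose Suc k) * (Suc k * (n - Suc k)) = (Suc k * (n choose Suc k)) * (Suc m - k)"
      by (simp only: d mult_ac)
    also have "\<dots> = n * ((Suc m - k) * (Suc m choose k))"
      unfolding binomial_absorption[of k n] by (simp only: n diff_Suc_1 mult_ac)
    also have "\<dots> = n * (Suc m * (m choose k))"
      using binomial_absorb_comp[of "Suc m" k] by simp
    finally show "(n choose Suc k) * (Suc k * (n - Suc k)) = n * (Suc m * (m choose k))" .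
  qed simp
  also have "\<dots> = n * (Suc m * (\<Sum>k\<le>m. m choose k))"
    by (simp only: flip: sum_distrib_left) (simp add: binomial_eq_0)
  finally have sum: "(\<Sum>k\<le>n. (n choose k) * (k * (n - k))) = n * (Suc m * 2 ^ m)"
    unfolding choose_row_sum .
  show ?thesis unfolding sum by (simp add: n algebra_simps)
qed

lemma card_near_pairs_closed:
  assumes "finite J"
  defines "n \<equiv> card J"
  shows "4 * card {(A, B). A \<subseteq> J \<and> B \<subseteq> J \<and> near A B} = 4 * (n + 1) * 2 ^ n + n * (n - 1) * 2 ^ n"
proof -
  have "(\<Sum>k\<le>n. (n choose k) * ((k + 1) * (n - k + 1))) =
      (\<Sum>k\<le>n. (n + 1) * (n choose k) + (n choose k) * (k * (n - k)))"
  proof (rule sum.cong)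
    fix k assume "k \<in> {..n}"
    then obtain d where "n = k + d" using le_Suc_ex by auto
    then show "(n choose k) * ((k + 1) * (n - k + 1)) =
        (n + 1) * (n choose k) + (n choose k) * (k * (n - k))"
      by (simp add: algebra_simps)
  qed simp
  also have "\<dots> = (n + 1) * 2 ^ n + (\<Sum>k\<le>n. (n choose k) * (k * (n - k)))"
    by (simp add: sum.distrib choose_row_sum flip: sum_distrib_left)
  finally have "card {(A, B). A \<subseteq> J \<and> B \<subseteq> J \<and> near A B} =
      (n + 1) * 2 ^ n + (\<Sum>k\<le>n. (n choose k) * (k * (n - k)))"
    unfolding n_def card_near_pairs[OF assms(1)] .
  then show ?thesis
    by (simp only: distrib_left[of 4 "(n + 1) * 2 ^ n"] choose_mixed_sum mult.assoc)
qed

section \<open>Counting functions with pairwise near values\<close>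

definition near_fns :: "'i set \<Rightarrow> 'a set \<Rightarrow> ('i \<Rightarrow> 'a set) set" where
  "near_fns I J = {f \<in> I \<rightarrow>\<^sub>E Pow J. \<forall>i\<in>I. \<forall>i'\<in>I. near (f i) (f i')}"

text \<open>
  The two alternatives of \<open>pairwise_near_iff\<close>, with a function \<open>f\<close> standing for the family of its
  values, indexed by the rows.
\<close>
definition below_fns :: "'i set \<Rightarrow> 'a set \<Rightarrow> ('i \<Rightarrow> 'a set) set" where
  "below_fns I J = {f \<in> I \<rightarrow>\<^sub>E Pow J. \<exists>S\<subseteq>J. f ` I \<subseteq> below1 S}"

definition above_fns :: "'i set \<Rightarrow> 'a set \<Rightarrow> ('i \<Rightarrow> 'a set) set" where
  "above_fns I J = {f \<in> I \<rightarrow>\<^sub>E Pow J. \<exists>K\<subseteq>J. f ` I \<subseteq> above1 J K}"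

lemma near_fns_eq:
  assumes "finite J"
  shows "near_fns I J = below_fns I J \<union> above_fns I J"
proof -
  have iff: "(\<forall>i\<in>I. \<forall>i'\<in>I. near (f i) (f i')) \<longleftrightarrow>
      (\<exists>S\<subseteq>J. f ` I \<subseteq> below1 S) \<or> (\<exists>K\<subseteq>J. f ` I \<subseteq> above1 J K)" if "f \<in> I \<rightarrow>\<^sub>E Pow J" for f
  proof -
    have "f ` I \<subseteq> Pow J" using that by (auto dest!: PiE_mem)
    from pairwise_near_iff[OF assms this] show ?thesis by simp
  qed
  show ?thesis
  proof (rule Set.set_eqI)
    fix f
    show "f \<in> near_fns I J \<longleftrightarrow> f \<in> below_fns I J \<union> above_fns I J"
      unfolding near_fns_def below_fns_def above_fns_def mem_Collect_eq Un_iff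
      by (cases "f \<in> I \<rightarrow>\<^sub>E Pow J") (simp_all only: iff simp_thms)
  qed
qed

text \<open>Taking complements in \<open>J\<close> exchanges removal from \<open>S\<close> with addition to \<open>J - S\<close>.\<close>
lemma card_above_fns: "card (above_fns I J) = card (below_fns I J)"
proof -
  let ?c = "\<lambda>f. \<lambda>i\<in>I. J - f i"
  have dd: "J - (J - A) = A" if "A \<subseteq> J" for A using that by blast
  have "bij_betw ?c (below_fns I J) (above_fns I J)"
  proof (rule bij_betw_byWitness[where f' = ?c])
    show "\<forall>f\<in>below_fns I J. ?c (?c f) = f"
      by (auto simp: below_fns_def PiE_iff extensional_def fun_eq_iff dd)
    show "\<forall>f\<in>above_fns I J. ?c (?c f) = f"
      by (auto simp: above_fns_def PiE_iff extensional_def fun_eq_iff dd)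
    show "?c ` below_fns I J \<subseteq> above_fns I J"
    proof
      fix g assume "g \<in> ?c ` below_fns I J"
      then obtain f S where g: "g = ?c f" and S: "S \<subseteq> J" "f ` I \<subseteq> below1 S"
        unfolding below_fns_def by blast
      have "J - f i \<in> above1 J (J - S)" if "i \<in> I" for i
      proof -
        have "(J - f i) - (J - S) = S - f i" using S(1) by blast
        then show ?thesis using S(2) that by (auto simp: above1_def below1_def)
      qed
      then have "g ` I \<subseteq> above1 J (J - S)" by (auto simp: g)
      moreover have "g \<in> I \<rightarrow>\<^sub>E Pow J" by (auto simp: g)
      ultimately show "g \<in> above_fns I J" unfolding above_fns_def by blast
    qed
    show "?c ` above_fns I J \<subseteq> below_fns I J"
    proof
      fix g assume "g \<in> ?c ` above_fns I J"
      then obtain f K where g: "g = ?c f" and K: "K \<subseteq> J" "f ` I \<subseteq> above1 J K"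
        unfolding above_fns_def by blast
      have "J - f i \<in> below1 (J - K)" if "i \<in> I" for i
      proof -
        have f: "f i \<subseteq> J" "K \<subseteq> f i" "card (f i - K) \<le> 1"
          using K(2) that by (auto simp: above1_def)
        then have "(J - K) - (J - f i) = f i - K" by blast
        with f show ?thesis by (auto simp: below1_def)
      qed
      then have "g ` I \<subseteq> below1 (J - K)" by (auto simp: g)
      moreover have "g \<in> I \<rightarrow>\<^sub>E Pow J" by (auto simp: g)
      ultimately show "g \<in> below_fns I J" unfolding below_fns_def by blast
    qed
  qed
  then show ?thesis by (simp add: bij_betw_same_card)
qed

text \<open>
  If the values do not cover \<open>S\<close>, some \<open>x\<close> is missing from all of them; as each value misses at most
  one element of \<open>S\<close>, all are \<open>S - {x}\<close>. So exactly \<open>card S\<close> functions into \<open>below1 S\<close>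
  fail to have union \<open>S\<close>.
\<close>
lemma card_spanning_below_fns:
  assumes I: "finite I" "I \<noteq> {}" and S: "finite S"
  shows "finite {f \<in> I \<rightarrow>\<^sub>E below1 S. \<Union>(f ` I) = S}"
    and "card {f \<in> I \<rightarrow>\<^sub>E below1 S. \<Union>(f ` I) = S} + card S = (card S + 1) ^ card I"
proof -
  let ?E = "{f \<in> I \<rightarrow>\<^sub>E below1 S. \<Union>(f ` I) = S}"
  let ?c = "\<lambda>x. \<lambda>i\<in>I. S - {x}"
  obtain i0 where i0: "i0 \<in> I" using I by blast
  have fin: "finite (I \<rightarrow>\<^sub>E below1 S)" using I S by (intro finite_PiE) (auto simp: below1_eq)
  then show fin_E: "finite ?E" by (rule finite_subset[rotated]) blast
  have "I \<rightarrow>\<^sub>E below1 S \<subseteq> ?E \<union> ?c ` S"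
  proof
    fix f assume f: "f \<in> I \<rightarrow>\<^sub>E below1 S"
    show "f \<in> ?E \<union> ?c ` S"
    proof (cases "\<Union>(f ` I) = S")
      case False
      have "\<Union>(f ` I) \<subseteq> S" using f by (fastforce simp: below1_def PiE_iff)
      with False obtain x where x: "x \<in> S" "x \<notin> \<Union>(f ` I)" by blast
      have "f i = S - {x}" if "i \<in> I" for i
      proof -
        have "f i \<in> insert S ((\<lambda>x. S - {x}) ` S)"
          using f that S by (simp add: PiE_iff below1_eq)
        then show ?thesis using x that by blast
      qed
      then have "f = ?c x" using f by (auto simp: PiE_iff extensional_def fun_eq_iff)
      then show ?thesis using x by blast
    qed (use f in blast)
  qed
  moreover have "?c ` S \<subseteq> I \<rightarrow>\<^sub>E below1 S" using S by (auto simp: below1_eq)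
  ultimately have un: "I \<rightarrow>\<^sub>E below1 S = ?E \<union> ?c ` S" by blast
  have disj: "?E \<inter> ?c ` S = {}"
  proof (rule equals0I)
    fix f assume f: "f \<in> ?E \<inter> ?c ` S"
    then obtain x where x: "x \<in> S" "f = ?c x" by (elim IntE imageE)
    have "x \<notin> \<Union>(f ` I)" unfolding x by simp
    moreover have "\<Union>(f ` I) = S" using f by (simp only: Int_iff mem_Collect_eq)
    ultimately show False using x by blast
  qed
  have "inj_on ?c S"
  proof (rule inj_onI)
    fix x y assume "x \<in> S" "y \<in> S" "?c x = ?c y"
    then have "S - {x} = S - {y}" using i0 by (metis restrict_apply')
    then show "x = y" using \<open>x \<in> S\<close> \<open>y \<in> S\<close> by blast
  qed
  then have "card (?c ` S) = card S" by (rule card_image)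
  moreover have "card (?E \<union> ?c ` S) = card ?E + card (?c ` S)"
    using fin_E finite_imageI[OF S] disj by (rule card_Un_disjoint)
  moreover have "card (I \<rightarrow>\<^sub>E below1 S) = (card S + 1) ^ card I"
    using I S by (simp add: card_PiE card_below1)
  ultimately show "card ?E + card S = (card S + 1) ^ card I" using un by (simp only:)
qed

text \<open>
  The witness \<open>S\<close> can always be shrunk to the union of the values, so the functions are partitioned
  by their union. The index set must be nonempty: otherwise the excluded constant functions coincide.
\<close>
lemma card_below_fns:
  assumes I: "finite I" "I \<noteq> {}" and J: "finite J"
  defines "m \<equiv> card I" and "n \<equiv> card J"
  shows "(of_nat (card (below_fns I J)) :: rat) =
    (\<Sum>k\<le>n. of_nat (n choose k) * of_nat (k + 1) ^ m) - of_nat n * 2 ^ n / 2"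
proof -
  let ?E = "\<lambda>S. {f \<in> I \<rightarrow>\<^sub>E below1 S. \<Union>(f ` I) = S}"
  have finS: "finite S" if "S \<in> Pow J" for S using that J finite_subset by blast
  have "below_fns I J = (\<Union>S\<in>Pow J. ?E S)"
  proof
    show "below_fns I J \<subseteq> (\<Union>S\<in>Pow J. ?E S)"
    proof
      fix f assume f: "f \<in> below_fns I J"
      then obtain S where S: "S \<subseteq> J" "f ` I \<subseteq> below1 S" unfolding below_fns_def by blast
      have sub: "\<Union>(f ` I) \<subseteq> S" using S(2) by (auto simp: below1_def)
      have "f i \<in> below1 (\<Union>(f ` I))" if "i \<in> I" for i
      proof -
        have "card (\<Union>(f ` I) - f i) \<le> card (S - f i)"
          using sub finS S(1) by (intro card_mono) auto
        also have "\<dots> \<le> 1" using S(2) that by (auto simp: below1_def)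
        finally show ?thesis using that by (auto simp: below1_def)
      qed
      then have "f \<in> ?E (\<Union>(f ` I))"
        using f unfolding below_fns_def by (auto simp: PiE_iff)
      moreover have "\<Union>(f ` I) \<in> Pow J" using sub S(1) by blast
      ultimately show "f \<in> (\<Union>S\<in>Pow J. ?E S)"
        by (intro UN_I[where a = "\<Union>(f ` I)"])
    qed
    show "(\<Union>S\<in>Pow J. ?E S) \<subseteq> below_fns I J"
    proof
      fix f assume "f \<in> (\<Union>S\<in>Pow J. ?E S)"
      then obtain S where S: "S \<subseteq> J" and f: "f \<in> I \<rightarrow>\<^sub>E below1 S" by blast
      have "below1 S \<subseteq> Pow J" using S by (auto simp: below1_def)
      then have "f \<in> I \<rightarrow>\<^sub>E Pow J" using f PiE_mono[of I "\<lambda>_. below1 S" "\<lambda>_. Pow J"] by blast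
      moreover have "f ` I \<subseteq> below1 S" using f by auto
      ultimately show "f \<in> below_fns I J" using S unfolding below_fns_def by blast
    qed
  qed
  then have "card (below_fns I J) = (\<Sum>S\<in>Pow J. card (?E S))"
  proof (simp only:, intro card_UN_disjoint ballI impI)
    show "finite (Pow J)" using J by simp
    show "finite (?E S)" if "S \<in> Pow J" for S
      by (rule card_spanning_below_fns(1)[OF I finS[OF that]])
    show "?E S \<inter> ?E S' = {}" if "S \<noteq> S'" for S S' using that by blast
  qed
  then have "(of_nat (card (below_fns I J)) :: rat) = (\<Sum>S\<in>Pow J. of_nat (card (?E S)))"
    by simp
  also have "\<dots> = (\<Sum>S\<in>Pow J. of_nat (card S + 1) ^ m - of_nat (card S))"
  proof (rule sum.cong)
    fix S assume "S \<in> Pow J"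
    from card_spanning_below_fns(2)[OF I finS[OF this]]
    have "(of_nat (card (?E S) + card S) :: rat) = of_nat ((card S + 1) ^ m)"
      unfolding m_def by (rule arg_cong)
    then show "(of_nat (card (?E S)) :: rat) = of_nat (card S + 1) ^ m - of_nat (card S)"
      by (simp only: of_nat_add of_nat_power eq_diff_eq)
  qed simp
  also have "\<dots> = (\<Sum>k\<le>n. of_nat (n choose k) * (of_nat (k + 1) ^ m - of_nat k))"
    unfolding n_def by (rule sum_Pow_card[OF J])
  also have "\<dots> = (\<Sum>k\<le>n. of_nat (n choose k) * of_nat (k + 1) ^ m) -
      of_nat (\<Sum>k\<le>n. k * (n choose k))"
    by (simp add: sum_subtractf algebra_simps)
  also have "(of_nat (\<Sum>k\<le>n. k * (n choose k)) :: rat) = of_nat n * 2 ^ n / 2"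
    unfolding choose_linear_sum by (cases n) (auto simp: algebra_simps)
  finally show ?thesis .
qed

text \<open>
  Two distinct sets \<open>S - {x}\<close>, \<open>S - {y}\<close> containing \<open>K\<close> leave \<open>x\<close>, \<open>y\<close> outside \<open>K\<close>. A third set
  below \<open>S\<close> would contain both of them, hence exceed \<open>K\<close> by two elements.
\<close>
lemma below1_above1_at_most_two:
  assumes S: "finite S" and ABC: "A \<in> below1 S \<inter> above1 J K"
    "B \<in> below1 S \<inter> above1 J K" "C \<in> below1 S \<inter> above1 J K"
  shows "A = B \<or> A = C \<or> B = C"
proof -
  have *: "X = Y \<or> X = Z \<or> Y = Z"
    if XY: "X \<noteq> S" "Y \<noteq> S" and m: "X \<in> below1 S \<inter> above1 J K"
      "Y \<in> below1 S \<inter> above1 J K" "Z \<in> below1 S \<inter> above1 J K" for X Y Z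
  proof (rule ccontr)
    assume d: "\<not> (X = Y \<or> X = Z \<or> Y = Z)"
    obtain x y where x: "x \<in> S" "X = S - {x}" and y: "y \<in> S" "Y = S - {y}"
      using XY m S by (auto simp: below1_eq)
    have Z: "Z = S \<or> (\<exists>z\<in>S. Z = S - {z})" using m S by (auto simp: below1_eq)
    have "x \<in> Z" "y \<in> Z" using Z x y d by blast+
    moreover have "x \<notin> K" "y \<notin> K" using m x y by (auto simp: above1_def)
    moreover have "card (Z - K) \<le> 1" using m by (auto simp: above1_def)
    moreover have "finite Z" using Z S by auto
    ultimately have "x = y" using card_Diff_le_1_unique by metis
    then show False using x y d by blast
  qed
  show ?thesis
    using *[of A B C] *[of A C B] *[of B C A] ABC by blast
qed

text \<open>
  A function with values among two near sets \<open>A\<close>, \<open>B\<close> lies below \<open>A \<union> B\<close> and above \<open>A \<inter> B\<close>;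
  conversely \<open>below1_above1_at_most_two\<close> leaves no room for a third value.
\<close>
lemma below_above_fns_eq:
  assumes I: "I \<noteq> {}" and J: "finite J"
  shows "below_fns I J \<inter> above_fns I J =
    {f. \<exists>A B. A \<subseteq> J \<and> B \<subseteq> J \<and> near A B \<and> f \<in> I \<rightarrow>\<^sub>E {A, B}}" (is "?L = ?R")
proof (intro equalityI subsetI)
  fix f assume f: "f \<in> ?L"
  have fb: "f \<in> below_fns I J" and fa: "f \<in> above_fns I J" using f by blast+
  obtain S where S: "S \<subseteq> J" "f ` I \<subseteq> below1 S" using fb unfolding below_fns_def by blast
  obtain K where K: "f ` I \<subseteq> above1 J K" using fa unfolding above_fns_def by blast
  have f': "f \<in> I \<rightarrow>\<^sub>E Pow J" using fb unfolding below_fns_def by blast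
  have near: "near (f i) (f i')" if "i \<in> I" "i' \<in> I" for i i'
  proof -
    have "f \<in> near_fns I J" unfolding near_fns_eq[OF J] using fb by (rule UnI1)
    then show ?thesis using that unfolding near_fns_def by blast
  qed
  have two: "f i = f i' \<or> f i = f i'' \<or> f i' = f i''" if "i \<in> I" "i' \<in> I" "i'' \<in> I" for i i' i''
  proof (rule below1_above1_at_most_two)
    show "finite S" using S(1) J by (rule finite_subset)
    show "f i \<in> below1 S \<inter> above1 J K" "f i' \<in> below1 S \<inter> above1 J K"
      "f i'' \<in> below1 S \<inter> above1 J K"
      using that S(2) K by blast+
  qed
  obtain i0 where i0: "i0 \<in> I" using I by blast
  obtain i1 where i1: "i1 \<in> I" "\<And>i. i \<in> I \<Longrightarrow> f i = f i0 \<or> f i = f i1"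
  proof (cases "\<exists>i\<in>I. f i \<noteq> f i0")
    case True
    then obtain i1 where "i1 \<in> I" "f i1 \<noteq> f i0" by blast
    then show thesis using that[of i1] two[of _ i0 i1] i0 by metis
  next
    case False
    then show thesis using that[of i0] i0 by blast
  qed
  have "f \<in> I \<rightarrow>\<^sub>E {f i0, f i1}" using f' i1 by (auto simp: PiE_iff)
  moreover have "f i0 \<subseteq> J" "f i1 \<subseteq> J" using f' i0 i1 by (auto simp: PiE_iff)
  ultimately show "f \<in> ?R" using near[OF i0 i1(1)] by blast
next
  fix f assume "f \<in> ?R"
  then obtain A B where A: "A \<subseteq> J" "B \<subseteq> J" "near A B" and f: "f \<in> I \<rightarrow>\<^sub>E {A, B}" by blast
  have e: "A \<union> B - A = B - A" "A \<union> B - B = A - B" "A - A \<inter> B = A - B" "B - A \<inter> B = B - A"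
    by blast+
  have "{A, B} \<subseteq> below1 (A \<union> B)" "{A, B} \<subseteq> above1 J (A \<inter> B)"
    using A by (auto simp: below1_def above1_def near_def e)
  moreover have "f ` I \<subseteq> {A, B}" using f by auto
  ultimately have "f ` I \<subseteq> below1 (A \<union> B)" "f ` I \<subseteq> above1 J (A \<inter> B)" by blast+
  moreover have "f \<in> I \<rightarrow>\<^sub>E Pow J" using f A by (auto simp: PiE_iff)
  moreover have "A \<union> B \<subseteq> J" "A \<inter> B \<subseteq> J" using A by blast+
  ultimately show "f \<in> ?L" unfolding below_fns_def above_fns_def by blast
qed

text \<open>
  Fix an index \<open>i0\<close>. A nonconstant function with two values is determined by the ordered pair
  consisting of its value \<open>A\<close> at \<open>i0\<close> and its other value \<open>B\<close>, together with the nonempty set of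
  indices, not containing \<open>i0\<close>, that are sent to \<open>B\<close>.
\<close>
lemma card_below_above_fns:
  assumes I: "finite I" "I \<noteq> {}" and J: "finite J"
  defines "m \<equiv> card I" and "n \<equiv> card J"
  shows "(of_nat (card (below_fns I J \<inter> above_fns I J)) :: rat) =
    2 ^ n + (of_nat n * 2 ^ n + of_nat n * (of_nat n - 1) * 2 ^ n / 4) * (2 ^ m / 2 - 1)"
proof -
  obtain i0 where i0: "i0 \<in> I" using I by blast
  define P where "P = {(A, B). A \<subseteq> J \<and> B \<subseteq> J \<and> near A B \<and> A \<noteq> B}"
  define X where "X = Pow (I - {i0}) - {{}}"
  define h where "h = (\<lambda>((A :: 'b set, B), Y). \<lambda>i\<in>I. if i \<in> Y then B else A)"
  define c where "c = (\<lambda>A :: 'b set. \<lambda>i\<in>I. A)"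
  have near_refl: "near A A" for A :: "'b set" by (simp add: near_def)
  have h_i0: "h ((A, B), Y) i0 = A" if "Y \<in> X" for A B Y
    using that i0 by (auto simp: h_def X_def)
  have h_Y: "Y = {i \<in> I. h ((A, B), Y) i \<noteq> A}" if "Y \<in> X" "A \<noteq> B" for A B Y
    using that by (auto simp: h_def X_def)
  have eq: "below_fns I J \<inter> above_fns I J = c ` Pow J \<union> h ` (P \<times> X)"
  proof (intro equalityI subsetI)
    fix f assume "f \<in> below_fns I J \<inter> above_fns I J"
    then obtain A B where A: "A \<subseteq> J" "B \<subseteq> J" "near A B" and f: "f \<in> I \<rightarrow>\<^sub>E {A, B}"
      unfolding below_above_fns_eq[OF I(2) J] by blast
    have *: "f \<in> c ` Pow J \<union> h ` (P \<times> X)"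
      if A: "A \<subseteq> J" "B \<subseteq> J" "near A B" and f: "f \<in> I \<rightarrow>\<^sub>E {A, B}" "f i0 = A" for A B
    proof (cases "\<forall>i\<in>I. f i = A")
      case True
      then have "f = c A" using f by (auto simp: c_def PiE_iff extensional_def fun_eq_iff)
      then show ?thesis using A by blast
    next
      case False
      then have "A \<noteq> B" using f by (auto simp: PiE_iff)
      then have "((A, B), {i \<in> I. f i \<noteq> A}) \<in> P \<times> X"
        using A False f(2) by (auto simp: P_def X_def)
      moreover have "f = h ((A, B), {i \<in> I. f i \<noteq> A})"
        using f by (auto simp: h_def PiE_iff extensional_def fun_eq_iff)
      ultimately show ?thesis by blast
    qed
    have "f i0 = A \<or> f i0 = B" using f i0 by (auto simp: PiE_iff)
    then show "f \<in> c ` Pow J \<union> h ` (P \<times> X)"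
      using *[OF A f] *[of B A] A f by (auto simp: near_def insert_commute)
  next
    fix f assume "f \<in> c ` Pow J \<union> h ` (P \<times> X)"
    then show "f \<in> below_fns I J \<inter> above_fns I J"
    proof
      assume "f \<in> c ` Pow J"
      then obtain A where "A \<subseteq> J" "f = c A" by blast
      then have "f \<in> I \<rightarrow>\<^sub>E {A, A}" by (auto simp: c_def)
      with \<open>A \<subseteq> J\<close> near_refl[of A] show ?thesis
        unfolding below_above_fns_eq[OF I(2) J] by blast
    next
      assume "f \<in> h ` (P \<times> X)"
      then obtain A B Y where AB: "(A, B) \<in> P" "f = h ((A, B), Y)" by auto
      then have "f \<in> I \<rightarrow>\<^sub>E {A, B}" by (auto simp: h_def)
      with AB(1) show ?thesis
        unfolding below_above_fns_eq[OF I(2) J] P_def by blast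
    qed
  qed
  have disj: "c ` Pow J \<inter> h ` (P \<times> X) = {}"
  proof -
    have "c A' \<noteq> h ((A, B), Y)" if "(A, B) \<in> P" "Y \<in> X" for A' A B Y
    proof
      assume e: "c A' = h ((A, B), Y)"
      have "A' = A" using fun_cong[OF e, of i0] h_i0[OF that(2)] i0 by (simp add: c_def)
      then have "{i \<in> I. h ((A, B), Y) i \<noteq> A} = {}" unfolding e[symmetric] by (auto simp: c_def)
      moreover have ne: "A \<noteq> B" using that by (auto simp: P_def)
      ultimately have "Y = {}" using h_Y[OF that(2) ne] by (simp only:)
      then show False using that(2) by (simp add: X_def)
    qed
    then show ?thesis by auto
  qed
  have finJ: "finite (Pow J)" and finX: "finite X" using I J by (auto simp: X_def)
  have finP: "finite P" by (rule finite_subset[of _ "Pow J \<times> Pow J"]) (use J in \<open>auto simp: P_def\<close>)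
  have "inj_on c (Pow J)"
  proof (rule inj_onI)
    fix A B assume "c A = c B"
    then show "A = B" using i0 unfolding c_def by (metis restrict_apply')
  qed
  then have card_c: "card (c ` Pow J) = 2 ^ n"
    using J by (simp add: card_image card_Pow n_def)
  have "inj_on h (P \<times> X)"
  proof (rule inj_onI)
    fix p q assume p: "p \<in> P \<times> X" and q: "q \<in> P \<times> X" and e: "h p = h q"
    obtain A B Y where p': "p = ((A, B), Y)" by (metis surj_pair)
    obtain A' B' Y' where q': "q = ((A', B'), Y')" by (metis surj_pair)
    have Y: "Y \<in> X" "A \<noteq> B" using p p' by (auto simp: P_def)
    have Y': "Y' \<in> X" "A' \<noteq> B'" using q q' by (auto simp: P_def)
    have "A = A'" using h_i0[OF Y(1), of A B] h_i0[OF Y'(1), of A' B'] e p' q' by simp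
    moreover from this have "Y = Y'" using h_Y[OF Y] h_Y[OF Y'] e p' q' by simp
    moreover obtain i where "i \<in> Y" "i \<in> I" using Y unfolding X_def by blast
    ultimately show "p = q" using fun_cong[OF e, of i] p' q' by (simp add: h_def)
  qed
  then have card_h: "card (h ` (P \<times> X)) = card P * card X"
    by (simp add: card_image card_cartesian_product)
  have "card (Pow (I - {i0})) = 2 ^ (m - 1)"
    using I i0 by (simp add: card_Pow m_def)
  then have "card X = 2 ^ (m - 1) - 1"
    unfolding X_def using I by (subst card_Diff_subset) auto
  moreover have "m \<noteq> 0" using I by (simp add: m_def)
  ultimately have card_X: "(of_nat (card X) :: rat) = 2 ^ m / 2 - 1"
    by (cases m) (auto simp: of_nat_diff)
  have "{(A, B). A \<subseteq> J \<and> B \<subseteq> J \<and> near A B} = (\<lambda>A. (A, A)) ` Pow J \<union> P"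
    using near_refl by (auto simp: P_def)
  then have "card {(A, B). A \<subseteq> J \<and> B \<subseteq> J \<and> near A B} = card ((\<lambda>A. (A, A)) ` Pow J) + card P"
    using finJ finP by (simp only:) (intro card_Un_disjoint, auto simp: P_def)
  also have "card ((\<lambda>A. (A, A)) ` Pow J) = 2 ^ n"
    using J by (simp add: card_image inj_on_def card_Pow n_def)
  finally have "4 * (2 ^ n + card P) = 4 * (n + 1) * 2 ^ n + n * (n - 1) * 2 ^ n"
    using card_near_pairs_closed[OF J] by (simp only: n_def)
  then have "(of_nat (4 * (2 ^ n + card P)) :: rat) =
      of_nat (4 * (n + 1) * 2 ^ n + n * (n - 1) * 2 ^ n)"
    by (rule arg_cong)
  then have card_P: "(of_nat (card P) :: rat) =
      of_nat n * 2 ^ n + of_nat n * (of_nat n - 1) * 2 ^ n / 4"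
    by (cases n) (auto simp: field_simps)
  have "card (below_fns I J \<inter> above_fns I J) = 2 ^ n + card P * card X"
    unfolding eq using card_Un_disjoint[OF finite_imageI[OF finJ] _ disj] finP finX card_c card_h
    by simp
  then show ?thesis by (simp add: card_X card_P)
qed

lemma card_near_fns:
  assumes I: "finite I" "I \<noteq> {}" and J: "finite J"
  defines "m \<equiv> card I" and "n \<equiv> card J"
  shows "(of_nat (card (near_fns I J)) :: rat) =
    2 * (\<Sum>k\<le>n. of_nat (n choose k) * of_nat (k + 1) ^ m) - (of_nat n + 1) * 2 ^ n
      - (of_nat n * 2 ^ n + of_nat n * (of_nat n - 1) * 2 ^ n / 4) * (2 ^ m / 2 - 1)"
proof -
  have fin: "finite (I \<rightarrow>\<^sub>E Pow J)" using I J by (intro finite_PiE) auto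
  have "finite (below_fns I J)" "finite (above_fns I J)"
    by (rule finite_subset[OF _ fin], auto simp: below_fns_def above_fns_def)+
  then have "card (below_fns I J) + card (above_fns I J) =
      card (near_fns I J) + card (below_fns I J \<inter> above_fns I J)"
    unfolding near_fns_eq[OF J] by (rule card_Un_Int)
  then have "(of_nat (card (near_fns I J)) :: rat) =
      2 * of_nat (card (below_fns I J)) - of_nat (card (below_fns I J \<inter> above_fns I J))"
    unfolding card_above_fns by (simp add: eq_diff_eq flip: of_nat_add)
  then show ?thesis
    unfolding card_below_fns[OF I J] card_below_above_fns[OF I J] m_def n_def
    by (simp add: algebra_simps)
qed

section \<open>Rows of matrices as sets\<close>

lemma submatrix_pair:
  assumes "i < i'" "i' < dim_row A" "j < j'" "j' < dim_col A"
  shows "submatrix A {i, i'} {j, j'} =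
    mat_of_rows_list 2 [[A $$ (i, j), A $$ (i, j')], [A $$ (i', j), A $$ (i', j')]]"
proof (rule eq_matI)
  let ?M = "mat_of_rows_list 2 [[A $$ (i, j), A $$ (i, j')], [A $$ (i', j), A $$ (i', j')]]"
  have c: "card {r. r < d \<and> r \<in> {a, b}} = 2" if "a < b" "b < d" for a b d :: nat
  proof -
    have "{r. r < d \<and> r \<in> {a, b}} = {a, b}" using that by auto
    then show ?thesis using that by simp
  qed
  have p: "pick {a, b} 0 = a" "pick {a, b} (Suc 0) = b" if "a < b" for a b :: nat
  proof -
    have a: "{x \<in> {a, b}. x < a} = {}" and b: "{x \<in> {a, b}. x < b} = {a}" using that by auto
    show "pick {a, b} 0 = a"
      using pick_card_in_set[of a "{a, b}"] unfolding a by (simp del: pick.simps)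
    show "pick {a, b} (Suc 0) = b"
      using pick_card_in_set[of b "{a, b}"] unfolding b by (simp del: pick.simps)
  qed
  {
    fix r s
    assume "r < dim_row ?M" "s < dim_col ?M"
    then have "r = 0 \<or> r = Suc 0" "s = 0 \<or> s = Suc 0" by (auto simp: mat_of_rows_list_def)
    then show "submatrix A {i, i'} {j, j'} $$ (r, s) = ?M $$ (r, s)"
      unfolding submatrix_def c[OF assms(1,2)] c[OF assms(3,4)]
      by (auto simp: p[OF assms(1)] p[OF assms(3)] mat_of_rows_list_def simp del: pick.simps)
  }
  show "dim_row (submatrix A {i, i'} {j, j'}) = dim_row ?M"
    unfolding dim_submatrix c[OF assms(1,2)] by (simp add: mat_of_rows_list_def)
  show "dim_col (submatrix A {i, i'} {j, j'}) = dim_col ?M"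
    unfolding dim_submatrix c[OF assms(3,4)] by (simp add: mat_of_rows_list_def)
qed

lemma mat_of_rows_list_2_eq_iff:
  "mat_of_rows_list 2 [[a, b], [c, d]] = mat_of_rows_list 2 [[a', b'], [c', d']] \<longleftrightarrow>
    a = a' \<and> b = b' \<and> c = c' \<and> d = d'" (is "?M = ?N \<longleftrightarrow> _")
proof
  assume eq: "?M = ?N"
  have "?M $$ (r, s) = ?N $$ (r, s)" for r s by (simp only: eq)
  from this[of 0 0] this[of 0 1] this[of 1 0] this[of 1 1]
  show "a = a' \<and> b = b' \<and> c = c' \<and> d = d'" by (simp add: mat_of_rows_list_def)
qed simp

definition row_supports :: "nat mat \<Rightarrow> nat \<Rightarrow> nat set" where
  "row_supports A = (\<lambda>i\<in>{..<dim_row A}. {j. j < dim_col A \<and> A $$ (i, j) = 1})"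

text \<open>
  Two columns in which row \<open>i\<close> is 1 and row \<open>i'\<close> is 0 form a forbidden submatrix, whichever of the
  two rows comes first. Avoidance therefore bounds both set differences of the supports by one
  element.
\<close>
lemma avoids_T_iff:
  assumes A: "A \<in> zero_one_mats m n"
  shows "avoids A T \<longleftrightarrow> (\<forall>i<m. \<forall>i'<m. near (row_supports A i) (row_supports A i'))"
proof -
  have dim: "dim_row A = m" "dim_col A = n" using A by (auto simp: zero_one_mats_def)
  have entry: "A $$ (i, j) = 0 \<or> A $$ (i, j) = 1" if "i < m" "j < n" for i j
    using A that by (fastforce simp: zero_one_mats_def)
  let ?bad = "\<lambda>i i' j j'. A $$ (i, j) = 1 \<and> A $$ (i, j') = 1 \<and> A $$ (i', j) = 0 \<and> A $$ (i', j') = 0"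
  have sub: "submatrix A {i, i'} {j, j'} \<in> exchange_class T \<longleftrightarrow> ?bad i i' j j' \<or> ?bad i' i j j'"
    if "i < i'" "i' < m" "j < j'" "j' < n" for i i' j j'
    using that by (auto simp: submatrix_pair dim exchange_class_T mat_of_rows_list_2_eq_iff)
  have diff: "card (row_supports A i - row_supports A i') \<le> 1 \<longleftrightarrow>
      (\<forall>j j'. j < j' \<and> j' < n \<longrightarrow> \<not> ?bad i i' j j')" if i: "i < m" "i' < m" for i i'
  proof -
    have mem: "j \<in> row_supports A i - row_supports A i' \<longleftrightarrow>
        j < n \<and> A $$ (i, j) = 1 \<and> A $$ (i', j) = 0" for j
      using i entry[of i' j] by (auto simp: row_supports_def dim)
    have "finite (row_supports A i - row_supports A i')"
      by (rule finite_subset[of _ "{..<n}"]) (use mem in auto)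
    then have "card (row_supports A i - row_supports A i') \<le> 1 \<longleftrightarrow>
        (\<forall>j\<in>row_supports A i - row_supports A i'. \<forall>j'\<in>row_supports A i - row_supports A i'. j = j')"
      (is "_ \<longleftrightarrow> (\<forall>j\<in>?D. \<forall>j'\<in>?D. j = j')")
      using card_le_Suc0_iff_eq by simp
    also have "\<dots> \<longleftrightarrow> (\<forall>j j'. j < j' \<longrightarrow> \<not> (j \<in> ?D \<and> j' \<in> ?D))"
      by (metis less_irrefl nat_neq_iff)
    also have "\<dots> \<longleftrightarrow> (\<forall>j j'. j < j' \<and> j' < n \<longrightarrow> \<not> ?bad i i' j j')"
      unfolding mem by (meson less_trans)
    finally show ?thesis .
  qed
  have near: "near (row_supports A i) (row_supports A i') \<longleftrightarrow>
      (\<forall>j j'. j < j' \<and> j' < n \<longrightarrow> \<not> ?bad i i' j j' \<and> \<not> ?bad i' i j j')"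
    if "i < m" "i' < m" for i i'
    unfolding near_def diff[OF that] diff[OF that(2,1)] by blast
  have "avoids A T \<longleftrightarrow>
      (\<forall>i i' j j'. i < i' \<and> i' < m \<and> j < j' \<and> j' < n \<longrightarrow> \<not> ?bad i i' j j' \<and> \<not> ?bad i' i j j')"
    unfolding avoids_def dim using sub by blast
  also have "\<dots> \<longleftrightarrow> (\<forall>i i'. i < i' \<and> i' < m \<longrightarrow> near (row_supports A i) (row_supports A i'))"
    using near by (meson less_trans)
  also have "\<dots> \<longleftrightarrow> (\<forall>i<m. \<forall>i'<m. near (row_supports A i) (row_supports A i'))"
  proof (intro iffI allI impI)
    fix i i'
    assume *: "\<forall>i i'. i < i' \<and> i' < m \<longrightarrow> near (row_supports A i) (row_supports A i')"
      and i: "i < m" "i' < m"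
    show "near (row_supports A i) (row_supports A i')"
      using i *[rule_format, of i i'] *[rule_format, of i' i]
      by (cases i i' rule: linorder_cases) (auto simp: near_def)
  qed auto
  finally show ?thesis .
qed

lemma phi_T_eq: "phi m n T = card (near_fns {..<m} {..<n})"
proof -
  let ?M = "{A \<in> zero_one_mats m n. avoids A T}"
  let ?g = "\<lambda>f. mat m n (\<lambda>(i, j). if j \<in> f i then 1 else 0 :: nat)"
  have "bij_betw row_supports ?M (near_fns {..<m} {..<n})"
  proof (rule bij_betw_byWitness[where f' = ?g])
    show "\<forall>A\<in>?M. ?g (row_supports A) = A"
    proof
      fix A assume "A \<in> ?M"
      then have A: "A \<in> zero_one_mats m n" by simp
      then have dim: "dim_row A = m" "dim_col A = n" by (auto simp: zero_one_mats_def)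
      have "A $$ (i, j) = 0 \<or> A $$ (i, j) = 1" if "i < m" "j < n" for i j
        using A that by (fastforce simp: zero_one_mats_def)
      then show "?g (row_supports A) = A"
        by (intro eq_matI) (auto simp: row_supports_def dim)
    qed
    have inv: "row_supports (?g f) = f" if "f \<in> near_fns {..<m} {..<n}" for f
    proof
      fix i
      have f: "f \<in> {..<m} \<rightarrow>\<^sub>E Pow {..<n}" using that by (simp add: near_fns_def)
      show "row_supports (?g f) i = f i"
      proof (cases "i < m")
        case True
        then have "f i \<subseteq> {..<n}" using f by (auto simp: PiE_iff)
        then show ?thesis using True by (auto simp: row_supports_def split: if_splits)
      next
        case False
        then show ?thesis using f by (simp add: row_supports_def PiE_iff extensional_def)
      qed
    qed
    then show "\<forall>f\<in>near_fns {..<m} {..<n}. row_supports (?g f) = f" by blast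
    show "row_supports ` ?M \<subseteq> near_fns {..<m} {..<n}"
    proof
      fix f assume "f \<in> row_supports ` ?M"
      then obtain A where f: "f = row_supports A" and A: "A \<in> zero_one_mats m n" "avoids A T" by blast
      have dim: "dim_row A = m" "dim_col A = n" using A(1) by (auto simp: zero_one_mats_def)
      have "f \<in> {..<m} \<rightarrow>\<^sub>E Pow {..<n}" by (auto simp: f row_supports_def dim)
      moreover have "\<forall>i<m. \<forall>i'<m. near (f i) (f i')" using avoids_T_iff[OF A(1)] A(2) f by simp
      ultimately show "f \<in> near_fns {..<m} {..<n}" by (simp add: near_fns_def)
    qed
    show "?g ` near_fns {..<m} {..<n} \<subseteq> ?M"
    proof
      fix A assume "A \<in> ?g ` near_fns {..<m} {..<n}"
      then obtain f where A: "A = ?g f" and f: "f \<in> near_fns {..<m} {..<n}" by blast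
      have zo: "A \<in> zero_one_mats m n" by (auto simp: A zero_one_mats_def elements_mat_def)
      have "\<forall>i<m. \<forall>i'<m. near (row_supports A i) (row_supports A i')"
        unfolding A inv[OF f] using f by (simp add: near_fns_def)
      then show "A \<in> ?M" using zo avoids_T_iff[OF zo] by simp
    qed
  qed
  then show ?thesis unfolding phi_def by (rule bij_betw_same_card)
qed

section \<open>The Lambert series\<close>

no_notation vec_index (infixl \<open>$\<close> 100)
unbundle fps_syntax

lemma X_exp_power_nth:
  fixes c :: "'a :: field_char_0"
  shows "(fps_const c * fps_X * fps_exp 1) ^ m $ n =
    (if n < m then 0 else c ^ m * of_nat m ^ (n - m) / fact (n - m))"
proof -
  have "(fps_const c * fps_X * fps_exp 1) ^ m = fps_const (c ^ m) * (fps_X ^ m * fps_exp (of_nat m))"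
    by (simp add: power_mult_distrib fps_exp_power_mult fps_const_power mult.assoc)
  then show ?thesis by (simp add: fps_X_power_mult_nth)
qed

text \<open>
  The factor \<open>c\<close> covers both substitutions used below: \<open>c = 1\<close> for the inverse function of \<open>W\<close>, and
  \<open>c = - 1\<close> for the argument \<open>- z e\<^sup>z\<close> of the theorem.
\<close>
lemma compose_X_exp_nth:
  fixes a :: "'a :: field_char_0 fps"
  shows "(a oo (fps_const c * fps_X * fps_exp 1)) $ n =
    (\<Sum>m\<le>n. a $ m * c ^ m * of_nat m ^ (n - m) / fact (n - m))"
  unfolding fps_compose_nth X_exp_power_nth
  by (intro sum.cong) (auto simp: field_simps)

text \<open>
  The sum is, up to \<open>fact r\<close>, the coefficient of \<open>X ^ r\<close> in \<open>(1 - e\<^sup>X) ^ n\<close>, a series of order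
  \<open>n\<close>.
\<close>
lemma alternating_choose_power_sum:
  assumes "r < n"
  shows "(\<Sum>m\<le>n. of_nat (n choose m) * (- 1) ^ m * of_nat m ^ r :: 'a :: field_char_0) = 0"
proof -
  have "0 = (1 - fps_exp (1 :: 'a)) ^ n $ r"
    using assms by (simp add: startsby_zero_power_prefix)
  also have "(1 - fps_exp (1 :: 'a)) ^ n =
      (\<Sum>m\<le>n. of_nat (n choose m) * (- 1) ^ m * fps_exp (of_nat m))"
    using binomial_ring[of "- fps_exp (1 :: 'a)" 1 n]
    by (simp add: power_minus[of "fps_exp 1"] fps_exp_power_mult mult.assoc)
  also have "\<dots> = (\<Sum>m\<le>n. fps_const (of_nat (n choose m) * (- 1) ^ m) * fps_exp (of_nat m))"
    by (simp flip: fps_const_mult fps_const_power fps_const_neg fps_of_nat)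
  finally have "0 = (\<Sum>m\<le>n. of_nat (n choose m) * (- 1) ^ m * (of_nat m ^ r / fact r) :: 'a)"
    by (simp add: fps_sum_nth)
  then have "0 = (\<Sum>m\<le>n. of_nat (n choose m) * (- 1) ^ m * of_nat m ^ r :: 'a) / fact r"
    by (simp add: sum_divide_distrib)
  then show ?thesis by simp
qed

lemma lambert_W_nth_Suc:
  "lambert_W $ Suc k = (- 1) ^ k * of_nat (Suc k) ^ k / fact (Suc k)"
  by (simp add: lambert_W_def power_minus[of "of_nat (Suc k)"] del: of_nat_Suc)

text \<open>
  The coefficient of \<open>X ^ n\<close> collects \<open>m ^ (m - 1)\<close> from \<open>W\<close> and \<open>m ^ (n - m)\<close> from \<open>e\<^sup>X\<close> into the
  power \<open>m ^ (n - 1)\<close>, whose \<open>n\<close>-th finite difference vanishes for \<open>n > 1\<close>.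
\<close>
lemma lambert_W_inverse: "lambert_W oo (fps_X * fps_exp 1) = fps_X"
proof (rule fps_ext)
  fix n
  have "(lambert_W oo (fps_X * fps_exp 1)) $ n =
      (\<Sum>m\<le>n. lambert_W $ m * of_nat m ^ (n - m) / fact (n - m))"
    using compose_X_exp_nth[of lambert_W 1 n] by simp
  also have "\<dots> = fps_X $ n"
  proof (cases "n \<le> 1")
    case True
    then consider "n = 0" | "n = 1" by linarith
    then show ?thesis by cases (auto simp: lambert_W_def)
  next
    case False
    have "(\<Sum>m\<le>n. lambert_W $ m * of_nat m ^ (n - m) / fact (n - m)) =
        (\<Sum>m\<le>n. - (of_nat (n choose m) * (- 1) ^ m * of_nat m ^ (n - 1) / fact n))"
    proof (rule sum.cong)
      fix m assume "m \<in> {..n}"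
      then have m: "m \<le> n" by simp
      show "lambert_W $ m * of_nat m ^ (n - m) / fact (n - m) =
          - (of_nat (n choose m) * (- 1) ^ m * of_nat m ^ (n - 1) / fact n)"
      proof (cases m)
        case 0
        with False show ?thesis by (simp add: lambert_W_def)
      next
        case (Suc k)
        have "(of_nat m :: rat) ^ (n - 1) = of_nat m ^ k * of_nat m ^ (n - m)"
          using m Suc by (simp flip: power_add)
        then show ?thesis using m Suc
          by (simp add: lambert_W_nth_Suc binomial_fact del: of_nat_Suc fact_Suc)
      qed
    qed simp
    also have "\<dots> = 0"
      using alternating_choose_power_sum[of "n - 1" n, where 'a = rat] False
      by (simp add: sum_negf flip: sum_divide_distrib)
    finally show ?thesis using False by simp
  qed
  finally show "(lambert_W oo (fps_X * fps_exp 1)) $ n = fps_X $ n" .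
qed

text \<open>
  Both sides have the same composition with \<open>f = X e\<^sup>X\<close>: the chain rule applied to \<open>W \<circ> f = X\<close>
  gives \<open>(W' \<circ> f) f' = 1\<close>, and \<open>X f' = f (1 + X)\<close>. Composition with \<open>f\<close> is injective because \<open>f\<close> has
  a compositional inverse.
\<close>
lemma lambert_W_ode: "fps_X * fps_deriv lambert_W * (1 + lambert_W) = lambert_W"
proof -
  define f :: "rat fps" where "f = fps_X * fps_exp 1"
  have f0: "f $ 0 = 0" and f1: "f $ 1 \<noteq> 0" by (simp_all add: f_def)
  have W: "lambert_W oo f = fps_X" unfolding f_def by (rule lambert_W_inverse)
  have "fps_X * fps_deriv lambert_W * (1 + lambert_W) oo f
      = f * (fps_deriv lambert_W oo f) * (1 + fps_X)"
    using f0 by (simp add: fps_compose_mult_distrib fps_compose_add_distrib W fps_X_fps_compose_startby0)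
  also have "\<dots> = fps_X * ((fps_deriv lambert_W oo f) * fps_deriv f)"
    by (simp add: f_def algebra_simps)
  also have "(fps_deriv lambert_W oo f) * fps_deriv f = 1"
    using fps_compose_deriv[OF f0, of lambert_W] W by simp
  finally have eq: "fps_X * fps_deriv lambert_W * (1 + lambert_W) oo f = lambert_W oo f"
    by (simp add: W)
  have "(a oo f) oo fps_inv f = a" for a
    using fps_compose_assoc[of "fps_inv f" f a] f0 fps_inv_right[OF f0 f1]
    by (simp add: fps_inv_def)
  with eq show ?thesis by metis
qed

text \<open>
  By \<open>lambert_W_ode\<close> the quotient is \<open>- 2 / X\<close> times the composition \<open>H\<close> of the explicit series
  \<open>X W'\<close> with \<open>- X e\<^sup>X\<close>.
\<close>
lemma lambert_quotient_nth:
  "((- 2 * lambert_W_comp) / (fps_X + fps_X * lambert_W_comp)) $ n =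
    2 * (\<Sum>k\<le>n. of_nat (n choose k) * of_nat (k + 1) ^ n) / fact n"
proof -
  define g :: "rat fps" where "g = - fps_X * fps_exp 1"
  define H where "H = fps_X * fps_deriv lambert_W oo g"
  define q where "q = - 2 * fps_shift 1 H"
  have g0: "g $ 0 = 0" by (simp add: g_def)
  have g: "g = fps_const (- 1) * fps_X * fps_exp 1"
    by (simp add: g_def flip: fps_const_neg)
  have w: "lambert_W_comp = lambert_W oo g" by (simp add: lambert_W_comp_def g_def)
  have "H * (1 + lambert_W_comp) = lambert_W_comp"
    unfolding H_def w using g0 arg_cong[OF lambert_W_ode, of "\<lambda>a. a oo g"]
    by (simp only: fps_compose_mult_distrib fps_compose_add_distrib fps_compose_1)
  moreover have "fps_X * fps_shift 1 H = H"
    by (rule fps_ext) (simp add: H_def)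
  ultimately have "q * (fps_X + fps_X * lambert_W_comp) = - 2 * lambert_W_comp"
    by (simp add: q_def algebra_simps)
  then have "(- 2 * lambert_W_comp) / (fps_X + fps_X * lambert_W_comp) = q"
    using lambert_W_comp_quotient_exact(2) by (metis nonzero_mult_div_cancel_right)
  then have "((- 2 * lambert_W_comp) / (fps_X + fps_X * lambert_W_comp)) $ n = - 2 * H $ Suc n"
    by (simp add: q_def numeral_fps_const)
  also have "H $ Suc n = (\<Sum>m\<le>Suc n. (fps_X * fps_deriv lambert_W) $ m * (- 1) ^ m *
      of_nat m ^ (Suc n - m) / fact (Suc n - m))"
    unfolding H_def g by (rule compose_X_exp_nth)
  also have "\<dots> = (\<Sum>k\<le>n. (fps_X * fps_deriv lambert_W) $ Suc k * (- 1) ^ Suc k *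
      of_nat (Suc k) ^ (n - k) / fact (n - k))"
    by (subst sum.atMost_Suc_shift) simp
  also have "\<dots> = (\<Sum>k\<le>n. - (of_nat (n choose k) * of_nat (k + 1) ^ n / fact n))"
  proof (rule sum.cong)
    fix k assume "k \<in> {..n}"
    then have k: "k \<le> n" by simp
    have "(of_nat (k + 1) :: rat) ^ n = of_nat (k + 1) ^ k * of_nat (k + 1) ^ (n - k)"
      using k by (simp flip: power_add)
    then show "(fps_X * fps_deriv lambert_W) $ Suc k * (- 1) ^ Suc k *
        of_nat (Suc k) ^ (n - k) / fact (n - k) =
        - (of_nat (n choose k) * of_nat (k + 1) ^ n / fact n)"
      using k by (simp add: lambert_W_nth_Suc binomial_fact)
  qed simp
  finally show ?thesis by (simp add: sum_negf flip: sum_divide_distrib)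
qed

lemma fact_mult_X_exp_nth:
  fixes c :: rat
  assumes "c \<noteq> 0"
  shows "fact n * (fps_X * fps_exp c) $ n = of_nat n * c ^ n / c"
    and "fact n * (fps_X ^ 2 * fps_exp c) $ n = of_nat n * (of_nat n - 1) * c ^ n / c ^ 2"
proof -
  show "fact n * (fps_X * fps_exp c) $ n = of_nat n * c ^ n / c"
    using assms by (cases n) (auto simp: field_simps)
  show "fact n * (fps_X ^ 2 * fps_exp c) $ n = of_nat n * (of_nat n - 1) * c ^ n / c ^ 2"
  proof (cases "n < 2")
    case True
    then consider "n = 0" | "n = 1" by linarith
    then show ?thesis by cases (auto simp: fps_X_power_mult_nth)
  next
    case False
    then obtain k where "n = Suc (Suc k)" by (metis add_2_eq_Suc le_Suc_ex not_less)
    then show ?thesis using assms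
      by (auto simp: fps_X_power_mult_nth field_simps power2_eq_square)
  qed
qed

section \<open>The generating function\<close>

text \<open>
  The inclusion-exclusion count needs at least one row; for \<open>n = 0\<close> the formula is checked against
  the empty matrix.
\<close>
lemma phi_T_square:
  "(of_nat (phi n n T) :: rat) =
    2 * (\<Sum>k\<le>n. of_nat (n choose k) * of_nat (k + 1) ^ n) - (of_nat n + 1) * 2 ^ n
      - (of_nat n * 2 ^ n + of_nat n * (of_nat n - 1) * 2 ^ n / 4) * (2 ^ n / 2 - 1)"
proof (cases "n = 0")
  case True
  then show ?thesis by (simp add: phi_0_0)
next
  case False
  then have "{..<n} \<noteq> {}" by auto
  from card_near_fns[OF finite_lessThan this finite_lessThan[of n]] show ?thesis
    by (simp only: phi_T_eq card_lessThan)
qed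

theorem mainTheorem6:
  shows "Abs_fps (\<lambda>n. of_nat (phi n n T) / fact n :: rat) =
    (- 2 * lambert_W_comp) / (fps_X + fps_X * lambert_W_comp)
      + (fps_X ^ 2 - 1) * fps_exp 2
      - 2 * fps_X * (fps_X + 1) * fps_exp 4"
proof (rule fps_ext)
  fix n
  let ?Q = "(- 2 * lambert_W_comp) / (fps_X + fps_X * lambert_W_comp)"
  let ?S = "(\<Sum>k\<le>n. of_nat (n choose k) * of_nat (k + 1) ^ n) :: rat"
  let ?R = "?Q + (fps_X ^ 2 - 1) * fps_exp 2 - 2 * fps_X * (fps_X + 1) * fps_exp 4"
  \<comment> \<open>Doubled summands are written as sums, so that coefficients are taken additively.\<close>
  have split: "?R = ?Q + fps_X ^ 2 * fps_exp 2 - fps_exp 2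
      - (fps_X ^ 2 * fps_exp 4 + fps_X ^ 2 * fps_exp 4) - (fps_X * fps_exp 4 + fps_X * fps_exp 4)"
    by (simp add: algebra_simps power2_eq_square)
  have "fact n * ?R $ n = fact n * ?Q $ n + fact n * (fps_X ^ 2 * fps_exp 2) $ n
      - fact n * fps_exp 2 $ n - 2 * (fact n * (fps_X ^ 2 * fps_exp 4) $ n)
      - 2 * (fact n * (fps_X * fps_exp 4) $ n)"
    unfolding split by (simp only: fps_add_nth fps_sub_nth) (simp only: algebra_simps mult_2)
  also have "\<dots> = 2 * ?S + of_nat n * (of_nat n - 1) * 2 ^ n / 2 ^ 2 - 2 ^ n
      - 2 * (of_nat n * (of_nat n - 1) * 4 ^ n / 4 ^ 2) - 2 * (of_nat n * 4 ^ n / 4)"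
  proof -
    have "fact n * ?Q $ n = 2 * ?S" unfolding lambert_quotient_nth by simp
    moreover have "fact n * fps_exp 2 $ n = (2 :: rat) ^ n" by simp
    moreover have
      "fact n * (fps_X ^ 2 * fps_exp 2) $ n = of_nat n * (of_nat n - 1) * 2 ^ n / (2 :: rat) ^ 2"
      "fact n * (fps_X ^ 2 * fps_exp 4) $ n = of_nat n * (of_nat n - 1) * 4 ^ n / (4 :: rat) ^ 2"
      "fact n * (fps_X * fps_exp 4) $ n = of_nat n * 4 ^ n / (4 :: rat)"
      by (rule fact_mult_X_exp_nth; simp)+
    ultimately show ?thesis by (simp only:)
  qed
  also have "\<dots> = of_nat (phi n n T)"
  proof -
    have "(4 :: rat) ^ n = 2 ^ n * 2 ^ n" by (simp flip: power_mult_distrib)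
    then show ?thesis unfolding phi_T_square by (simp add: field_simps)
  qed
  finally have "of_nat (phi n n T) / fact n = ?R $ n"
    using nonzero_mult_div_cancel_left[of "fact n :: rat" "?R $ n"] fact_nonzero[of n] by (simp only:)
  then show "Abs_fps (\<lambda>n. of_nat (phi n n T) / fact n :: rat) $ n = ?R $ n"
    by (simp only: fps_nth_Abs_fps)
qed

end
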